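(* Let $A\in\mathbb{R}^{n\times n}$, $B\in\mathbb{R}^{n\times m}$, let $U_0,U_0^\star\in\mathbb{R}^{m\times T}$ and $X_0,X_0^\star,X_1,X_1^\star\in\mathbb{R}^{n\times T}$ be the measured (unstarred) and accurate (starred) data matrices of the LTI system $x(k+1)=Ax(k)+Bu(k)$, so that $X_1^\star=\begin{bmatrix}B&A\end{bmatrix}\begin{bmatrix}U_0^\star\\ X_0^\star\end{bmatrix}$. Suppose that: (i) $\operatorname{rank}\begin{bmatrix}U_0\\ X_0\end{bmatrix}=m+n$; (ii) there are matrices $\delta_X,\delta_{UX}$ and real numbers $r_{X,1}$, $r_{UX,0}$ with $X_1^\star=X_1+\delta_X$, $\begin{bmatrix}U_0^\star\\ X_0^\star\end{bmatrix}=\begin{bmatrix}U_0\\ X_0\end{bmatrix}+\delta_{UX}$, and $$\frac{\|\delta_X\|}{\|X_1^\star\|}\le r_{X,1},\qquad \frac{\|\delta_{UX}\|}{\left\|\begin{bmatrix}U_0^\star\\ X_0^\star\end{bmatrix}\right\|}\le r_{UX,0}<1;$$ (iii) $\operatorname{rank}\begin{bmatrix}U_0^\star\\ X_0^\star\end{bmatrix}=m+n$, $\left\|\begin{bmatrix}U_0^\star\\ X_0^\star\end{bmatrix}\right\|<\infty$ and $\left\|\begin{bmatrix}U_0\\ X_0\end{bmatrix}\right\|<\infty$. Let $\begin{bmatrix}U_0\\ X_0\end{bmatrix}^\dagger_R$ be a right inverse of $\begin{bmatrix}U_0\\ X_0\end{bmatrix}$, let $\begin{bmatrix}B^e&A^e\end{bmatrix}:=X_1\begin{bmatrix}U_0\\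 X_0\end{bmatrix}^\dagger_R$, $\delta_{BA}:=\begin{bmatrix}B&A\end{bmatrix}-\begin{bmatrix}B^e&A^e\end{bmatrix}$, and $c_{UX}:=\left\|\begin{bmatrix}U_0\\ X_0\end{bmatrix}\right\|\left\|\begin{bmatrix}U_0\\ X_0\end{bmatrix}^\dagger_R\right\|$. If moreover $$\overline{c}:=c_{UX}\,\frac{r_{X,1}+r_{UX,0}}{1-r_{UX,0}}<1,$$ then $$\|\delta_{BA}\|\le\frac{\overline{c}}{1-\overline{c}}\left\|\begin{bmatrix}B^e&A^e\end{bmatrix}\right\|.$$
   Context: $\|\cdot\|$ denotes the matrix $2$-norm (spectral norm). The LTI system is $x(k+1)=Ax(k)+Bu(k)$ with $x\in\mathbb{R}^n$, $u\in\mathbb{R}^m$. For a time horizon $T$, the measured (noisy) data matrices are $U_0=[u_d(0),\dots,u_d(T-1)]$, $X_0=[x_d(0),\dots,x_d(T-1)]$, $X_1=[x_d(1),\dots,x_d(T)]$, where $u_d(k),x_d(k)$ are the measured input and state at time $k$. The matrices $U_0^\star,X_0^\star,X_1^\star$ are built in the same way from the accurate (noise-free) inputs and states, which satisfy the system equation, so that $X_1^\star=\begin{bmatrix}B&A\end{bmatrix}\begin{bmatrix}U_0^\star\\ X_0^\star\end{bmatrix}$ and hence $\begin{bmatrix}B&A\end{bmatrix}=X_1^\star\begin{bmatrix}U_0^\star\\ X_0^\star\end{bmatrix}^\dagger_R$. The subscript $R$ on $\dagger$ denotes a right inverse: $MM^\dagger_R=I$. The quotients by norms presuppose nonzero denominators,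 i.e. $X_1^\star\neq0$. *)

theory Defs
  imports "HOL-Analysis.Analysis"
begin

definition spectral_norm :: "real^'c::finite^'r::finite \<Rightarrow> real" where
  "spectral_norm M = onorm (\<lambda>v. M *v v)"

definition vstack :: "real^'c::finite^'a::finite \<Rightarrow> real^'c^'b::finite \<Rightarrow> real^'c^('a + 'b)" where
  "vstack M N = (\<chi> i. case i of Inl a \<Rightarrow> M $ a | Inr b \<Rightarrow> N $ b)"

definition hstack :: "real^'a::finite^'r::finite \<Rightarrow> real^'b::finite^'r \<Rightarrow> real^('a + 'b)^'r" where
  "hstack M N = (\<chi> i j. case j of Inl a \<Rightarrow> M $ i $ a | Inr b \<Rightarrow> N $ i $ b)"

text \<open>
  The horizon \<open>T\<close> is \<open>CARD('t)\<close>. The order on the column index type serves only to number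
  the columns \<open>0, \<dots>, T - 1\<close>; a column \<open>j\<close> has number \<open>card {..<j}\<close>. Thus
  \<open>data_matrix s w\<close> is the matrix with columns \<open>w s, w (s + 1), \<dots>, w (s + T - 1)\<close>.
\<close>
definition data_matrix :: "nat \<Rightarrow> (nat \<Rightarrow> real^'a::finite) \<Rightarrow> real^'t::{finite,linorder}^'a" where
  "data_matrix s w = (\<chi> i j. w (s + card {..<j}) $ i)"

lemma bij_betw_column_number:
  "bij_betw (\<lambda>j::'t::{finite,linorder}. card {..<j}) UNIV {..<CARD('t)}"
proof -
  have less: "card {..<i} < card {..<j}" if "i < j" for i j :: 't
    using that by (intro psubset_card_mono) auto
  have inj: "inj (\<lambda>j::'t. card {..<j})"
    by (rule linorder_injI) (use less in fastforce)
  have "card {..<j} < CARD('t)" for j :: 't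
    by (intro psubset_card_mono) auto
  then have "range (\<lambda>j::'t. card {..<j}) \<subseteq> {..<CARD('t)}"
    by auto
  moreover have "card (range (\<lambda>j::'t. card {..<j})) = card {..<CARD('t)}"
    using inj by (simp add: card_image)
  ultimately have "range (\<lambda>j::'t. card {..<j}) = {..<CARD('t)}"
    by (intro card_subset_eq) auto
  with inj show ?thesis
    by (simp add: bij_betw_def)
qed

lemma data_matrix_system_equation:
  fixes A :: "real^'n^'n" and B :: "real^'m^'n"
    and u :: "nat \<Rightarrow> real^'m" and x :: "nat \<Rightarrow> real^'n"
  assumes "\<And>k. k < CARD('t::{finite,linorder}) \<Longrightarrow> x (k + 1) = A *v x k + B *v u k"
  shows "(data_matrix 1 x :: real^'t::{finite,linorder}^'n) = hstack B A ** vstack (data_matrix 0 u) (data_matrix 0 x)"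
proof -
  have "x (Suc (card {..<j})) = A *v x (card {..<j}) + B *v u (card {..<j})" for j :: 't
    using assms[of "card {..<j}"] bij_betw_column_number[where 't='t]
    by (auto simp: bij_betw_def)
  then show ?thesis
    by (simp add: vec_eq_iff data_matrix_def hstack_def vstack_def matrix_matrix_mult_def
        matrix_vector_mult_def UNIV_Plus_UNIV[symmetric] sum.Plus del: UNIV_Plus_UNIV)
qed

end

(*
  With M = [B A], D the measured and D* = D + d the accurate stacked data, E = X1 R and D R = I,
  multiplying M D* = X1 + dX by R from the right gives M - E = dX R - M d R.  Both terms are
  bounded by multiples of |M| |D*| |R|, where |D*| <= |D| / (1 - r0) because D* - D is
  relatively small, so |M - E| <= c |M| <= c (|E| + |M - E|).
*)
theory Submission
  imports Defs
begin

lemma spectral_norm_nonneg: "0 \<le> spectral_norm M"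
  unfolding spectral_norm_def by (rule onorm_pos_le) (rule matrix_vector_mul_bounded_linear)

text \<open>A nonzero matrix moves some vector. This makes the denominators of the relative errors
  positive, so that bounds on quotients become bounds on products.\<close>

lemma spectral_norm_pos:
  assumes "M \<noteq> 0"
  shows "0 < spectral_norm M"
proof -
  have "\<not> (\<forall>v. M *v v = 0)"
    using assms by (metis matrix_eq matrix_vector_mult_0)
  then show ?thesis
    unfolding spectral_norm_def
    by (subst onorm_pos_lt) (auto simp: matrix_vector_mul_bounded_linear)
qed

lemma spectral_norm_minus: "spectral_norm (- M) = spectral_norm M"
proof -
  have "(\<lambda>v. (- M) *v v) = (\<lambda>v. - (M *v v))"
    by (simp add: fun_eq_iff vec_eq_iff matrix_vector_mult_def sum_negf)
  then show ?thesis
    by (simp add: spectral_norm_def onorm_neg)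
qed

lemma spectral_norm_triangle: "spectral_norm (M + N) \<le> spectral_norm M + spectral_norm N"
  unfolding spectral_norm_def matrix_vector_mult_add_rdistrib
  by (intro onorm_triangle matrix_vector_mul_bounded_linear)

lemma spectral_norm_triangle_diff: "spectral_norm (M - N) \<le> spectral_norm M + spectral_norm N"
  using spectral_norm_triangle[of M "- N"] by (simp add: spectral_norm_minus)

lemma spectral_norm_mult: "spectral_norm (M ** N) \<le> spectral_norm M * spectral_norm N"
proof -
  have "(\<lambda>v. (M ** N) *v v) = (\<lambda>v. M *v v) \<circ> (\<lambda>v. N *v v)"
    by (simp add: fun_eq_iff matrix_vector_mul_assoc)
  then show ?thesis
    unfolding spectral_norm_def
    using onorm_compose[OF matrix_vector_mul_bounded_linear[of M] matrix_vector_mul_bounded_linear[of N]]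
    by simp
qed

lemma matrix_add_rdistrib:
  fixes A B :: "'a::semiring_1^'n::finite^'m" and C :: "'a^'k^'n"
  shows "(A + B) ** C = A ** C + B ** C"
  by (simp add: vec_eq_iff matrix_matrix_mult_def distrib_right sum.distrib)

text \<open>The perturbation estimate freed of trajectories and block structure: \<open>X\<close>
  and \<open>D\<close> are measured, \<open>dX\<close> and \<open>d\<close> their errors, and only
  the exact data \<open>X + dX\<close> and \<open>D + d\<close> are linked by
  \<open>M\<close>.\<close>

lemma right_inverse_estimate_error:
  fixes M :: "real^'k::finite^'n::finite" and D d :: "real^'t::finite^'k"
    and X dX :: "real^'t^'n" and R :: "real^'k^'t"
  assumes system: "X + dX = M ** (D + d)"
    and nonzero: "X + dX \<noteq> 0"
    and right_inverse: "D ** R = mat 1"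
    and r1: "spectral_norm dX / spectral_norm (X + dX) \<le> r1"
    and r0: "spectral_norm d / spectral_norm (D + d) \<le> r0" "r0 < 1"
    and c: "c = spectral_norm D * spectral_norm R * ((r1 + r0) / (1 - r0))" "c < 1"
  shows "spectral_norm (M - X ** R) \<le> c / (1 - c) * spectral_norm (X ** R)"
proof -
  let ?D = "D + d" and ?E = "X ** R" and ?e = "M - X ** R"
  \<comment> \<open>If \<open>?D\<close> vanished, so would the product \<open>M ** ?D\<close>,
    which equals \<open>X + dX\<close>.\<close>
  have "?D \<noteq> 0"
    using system nonzero by (metis times0_right)
  then have D_pos: "0 < spectral_norm ?D"
    by (rule spectral_norm_pos)
  have X_pos: "0 < spectral_norm (X + dX)"
    using nonzero by (rule spectral_norm_pos)
  \<comment> \<open>The signs of \<open>r1\<close> and \<open>r0\<close> come from their being upper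
    bounds for quotients of norms.\<close>
  have r1_nonneg: "0 \<le> r1"
    using r1 by (rule order_trans[rotated]) (simp add: spectral_norm_nonneg)
  have r0_nonneg: "0 \<le> r0"
    using r0(1) by (rule order_trans[rotated]) (simp add: spectral_norm_nonneg)
  have d_le: "spectral_norm d \<le> r0 * spectral_norm ?D"
    using r0(1) D_pos by (simp add: divide_le_eq)
  have "spectral_norm dX \<le> r1 * spectral_norm (X + dX)"
    using r1 X_pos by (simp add: divide_le_eq)
  \<comment> \<open>The system equation trades the norm of \<open>X + dX\<close> for the product of
    the norms of \<open>M\<close> and \<open>?D\<close>, the scale in which the other error term is
    also bounded.\<close>
  also have "\<dots> \<le> r1 * (spectral_norm M * spectral_norm ?D)"
    using r1_nonneg by (intro mult_left_mono) (simp_all add: system spectral_norm_mult)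
  finally have dX_le: "spectral_norm dX \<le> r1 * (spectral_norm M * spectral_norm ?D)" .
  \<comment> \<open>The triangle inequality bounds the norm of \<open>?D\<close> by that of
    \<open>D\<close> plus \<open>r0\<close> times itself; the last term is absorbed on the left, as
    \<open>1 - r0\<close> is positive.\<close>
  have D_le: "spectral_norm ?D \<le> spectral_norm D / (1 - r0)"
    using spectral_norm_triangle[of D d] d_le r0(2) by (simp add: field_simps)

  have "(X + dX) ** R = M ** (D ** R) + M ** d ** R"
    by (simp add: system matrix_add_ldistrib matrix_add_rdistrib matrix_mul_assoc)
  then have "?e = dX ** R - M ** d ** R"
    by (simp add: right_inverse matrix_add_rdistrib algebra_simps)
  then have "spectral_norm ?e \<le> spectral_norm (dX ** R) + spectral_norm (M ** d ** R)"
    by (simp add: spectral_norm_triangle_diff)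
  also have "\<dots> \<le> spectral_norm dX * spectral_norm R
      + spectral_norm M * spectral_norm d * spectral_norm R"
    by (intro add_mono order_trans[OF spectral_norm_mult] mult_right_mono spectral_norm_mult
        spectral_norm_nonneg order_refl)
  also have "\<dots> \<le> r1 * (spectral_norm M * spectral_norm ?D) * spectral_norm R
      + spectral_norm M * (r0 * spectral_norm ?D) * spectral_norm R"
    by (intro add_mono mult_right_mono mult_left_mono dX_le d_le spectral_norm_nonneg)
  also have "\<dots> = spectral_norm M * spectral_norm R * (r1 + r0) * spectral_norm ?D"
    by (simp add: algebra_simps)
  also have "\<dots> \<le> spectral_norm M * spectral_norm R * (r1 + r0) * (spectral_norm D / (1 - r0))"
    using r0_nonneg r1_nonneg
    by (intro mult_left_mono D_le) (simp add: spectral_norm_nonneg)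
  also have "\<dots> = c * spectral_norm M"
    by (simp add: c(1))
  \<comment> \<open>The true \<open>M\<close> must not appear in the final bound, so it is split as
    \<open>?E + ?e\<close>; the error then occurs on both sides.\<close>
  also have "\<dots> \<le> c * (spectral_norm ?E + spectral_norm ?e)"
  proof (rule mult_left_mono)
    show "spectral_norm M \<le> spectral_norm ?E + spectral_norm ?e"
      using spectral_norm_triangle[of ?E ?e] by simp
    show "0 \<le> c"
      using r0_nonneg r1_nonneg r0(2) by (simp add: c(1) spectral_norm_nonneg)
  qed
  \<comment> \<open>Solving for the norm of \<open>?e\<close> divides by \<open>1 - c\<close>, which
    is positive.\<close>
  finally show ?thesis
    using c(2) by (simp add: field_simps)
qed

theorem mainTheorem2:
  fixes A Ae :: "real^'n^'n" and B Be :: "real^'m^'n"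
    and u u_star :: "nat \<Rightarrow> real^'m" and x x_star :: "nat \<Rightarrow> real^'n"
    and U0 U0_star :: "real^'t::{finite,linorder}^'m"
    and X0 X0_star X1 X1_star :: "real^'t::{finite,linorder}^'n"
    and \<delta>X :: "real^'t::{finite,linorder}^'n" and \<delta>UX :: "real^'t::{finite,linorder}^('m + 'n)"
    and R :: "real^('m + 'n)^'t::{finite,linorder}"
    and \<delta>BA :: "real^('m + 'n)^'n"
    and rX1 rUX0 cUX cbar :: real
  assumes measured: "U0 = data_matrix 0 u" "X0 = data_matrix 0 x" "X1 = data_matrix 1 x"
    and accurate: "U0_star = data_matrix 0 u_star" "X0_star = data_matrix 0 x_star"
      "X1_star = data_matrix 1 x_star"
    and system: "\<And>k. k < CARD('t) \<Longrightarrow> x_star (k + 1) = A *v x_star k + B *v u_star k"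
    and X1_star_nonzero: "X1_star \<noteq> 0"
    and rank_measured: "rank (vstack U0 X0) = CARD('m) + CARD('n)"
    and \<delta>X: "X1_star = X1 + \<delta>X"
    and \<delta>UX: "vstack U0_star X0_star = vstack U0 X0 + \<delta>UX"
    and rX1: "spectral_norm \<delta>X / spectral_norm X1_star \<le> rX1"
    and rUX0: "spectral_norm \<delta>UX / spectral_norm (vstack U0_star X0_star) \<le> rUX0" "rUX0 < 1"
    and rank_accurate: "rank (vstack U0_star X0_star) = CARD('m) + CARD('n)"
    and finite_norms: "ereal (spectral_norm (vstack U0_star X0_star)) < \<infinity>"
      "ereal (spectral_norm (vstack U0 X0)) < \<infinity>"
    and right_inverse: "vstack U0 X0 ** R = mat 1"
    and estimate: "hstack Be Ae = X1 ** R"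
    and \<delta>BA: "\<delta>BA = hstack B A - hstack Be Ae"
    and cUX: "cUX = spectral_norm (vstack U0 X0) * spectral_norm R"
    and cbar: "cbar = cUX * ((rX1 + rUX0) / (1 - rUX0))" "cbar < 1"
  shows "spectral_norm \<delta>BA \<le> cbar / (1 - cbar) * spectral_norm (hstack Be Ae)"
proof -
  have "X1_star = hstack B A ** vstack U0_star X0_star"
    unfolding accurate by (rule data_matrix_system_equation) (rule system)
  then have "X1 + \<delta>X = hstack B A ** (vstack U0 X0 + \<delta>UX)"
    by (simp add: \<delta>X \<delta>UX)
  \<comment> \<open>Here \<open>M\<close> is \<open>hstack B A\<close> and \<open>D\<close> is
    \<open>vstack U0 X0\<close>; the unfoldings rewrite each accurate matrix as measured data plus
    error.\<close>
  from right_inverse_estimate_error[OF this X1_star_nonzero[unfolded \<delta>X] right_inverse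
      rX1[unfolded \<delta>X] rUX0(1)[unfolded \<delta>UX] rUX0(2) cbar(1)[unfolded cUX] cbar(2)]
  show ?thesis
    by (simp add: \<delta>BA estimate)
qed

end
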